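(* Let $d\ge1$, $0<c_j<1$ for $j\in D=\{1,\dots,d\}$, let $\mathbf{X}_0$ and $\mathbf{Y}_n=(Y_{n,1},\dots,Y_{n,d})$, $n\ge1$, be independent random vectors in $\mathbb{R}^d$ with $\mathbf{Y}_n\sim G$ for all $n$, and let $X_{n,j}=\max(c_jX_{n-1,j},\,Y_{n,j})$ for $n\ge1$, $j\in D$. Suppose $\{\mathbf{X}_n=(X_{n,1},\dots,X_{n,d})\}$ is stationary with common distribution function $F$ having continuous margins $F_1,\dots,F_d$. Let $j,j'\in D$ and let $r\ge1$ be an integer. If $F_{j'}$ has positive finite right end-point, then $\lambda_{jj'}^{(r)}(\mathbf{X})=0$ and $\eta_{jj'}^{(r)}(\mathbf{X})=1/2$.
   Context: The lag-$r$ tail dependence coefficient is $\lambda_{jj'}^{(r)}(\mathbf{X})=\lim_{t\downarrow0}P\big(F_{j'}(X_{1+r,j'})>1-t\,\big|\,F_j(X_{1,j})>1-t\big)$. The lag-$r$ Ledford and Tawn coefficient $\eta_{jj'}^{(r)}(\mathbf{X})\in(0,1]$ is the constant such that $$P\big(F_{j'}(X_{1+r,j'})>1-t\,\big|\,F_j(X_{1,j})>1-t\big)\sim L(t)\,t^{1/\eta_{jj'}^{(r)}(\mathbf{X})-1}\quad\text{as }t\downarrow0,$$ for some function $L$ slowly varying at $0$, i.e. $L(tx)/L(t)\to1$ as $t\downarrow0$ for every fixed $x>0$. The right end-point of $F_{j'}$ is $\sup\{x:F_{j'}(x)<1\}$. *)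

theory Defs
  imports "HOL-Probability.Probability" "HOL-Library.Landau_Symbols"
begin

text \<open>Random vectors in \<open>\<real>\<^sup>d\<close> are \<open>real ^ 'd\<close>-valued with \<open>d = CARD('d)\<close>; a probability
  distribution is represented by its Borel measure.\<close>

definition margin_df :: "(real ^ 'd::finite) measure \<Rightarrow> 'd \<Rightarrow> real \<Rightarrow> real" where
  "margin_df F j = cdf (distr F borel (\<lambda>x. x $ j))"

text \<open>The supremum is taken in \<open>ereal\<close>, so that an empty or unbounded set gives
  \<open>-\<infinity>\<close> or \<open>\<infinity>\<close> rather than an unspecified real.\<close>

definition right_endpoint :: "(real \<Rightarrow> real) \<Rightarrow> ereal" where
  "right_endpoint H = (SUP x \<in> {x. H x < 1}. ereal x)"

definition strictly_stationary :: "'a measure \<Rightarrow> (nat \<Rightarrow> 'a \<Rightarrow> 'b::topological_space) \<Rightarrow> bool" where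
  "strictly_stationary M Z \<longleftrightarrow>
     (\<forall>h. distr M (PiM UNIV (\<lambda>_. borel)) (\<lambda>\<omega> n. Z (n + h) \<omega>)
        = distr M (PiM UNIV (\<lambda>_. borel)) (\<lambda>\<omega> n. Z n \<omega>))"

definition slowly_varying_at_0 :: "(real \<Rightarrow> real) \<Rightarrow> bool" where
  "slowly_varying_at_0 L \<longleftrightarrow> (\<forall>x>0. ((\<lambda>t. L (t * x) / L t) \<longlongrightarrow> 1) (at_right 0))"

text \<open>In the following, \<open>F\<close> is the common distribution of the \<open>X n\<close>, \<open>n \<ge> 1\<close>.\<close>

definition lag_exceedance_prob ::
  "'a measure \<Rightarrow> (real ^ 'd::finite) measure \<Rightarrow> (nat \<Rightarrow> 'a \<Rightarrow> real ^ 'd) \<Rightarrow> 'd \<Rightarrow> 'd \<Rightarrow> nat \<Rightarrow> real \<Rightarrow> real"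
  where
  "lag_exceedance_prob M F X j j' r t =
     cond_prob M (\<lambda>\<omega>. margin_df F j' (X (1 + r) \<omega> $ j') > 1 - t)
                 (\<lambda>\<omega>. margin_df F j (X 1 \<omega> $ j) > 1 - t)"

definition tail_dependence_coeff ::
  "'a measure \<Rightarrow> (real ^ 'd::finite) measure \<Rightarrow> (nat \<Rightarrow> 'a \<Rightarrow> real ^ 'd) \<Rightarrow> 'd \<Rightarrow> 'd \<Rightarrow> nat \<Rightarrow> real"
  where
  "tail_dependence_coeff M F X j j' r = Lim (at_right 0) (lag_exceedance_prob M F X j j' r)"

definition is_ledford_tawn_coeff ::
  "'a measure \<Rightarrow> (real ^ 'd::finite) measure \<Rightarrow> (nat \<Rightarrow> 'a \<Rightarrow> real ^ 'd) \<Rightarrow> 'd \<Rightarrow> 'd \<Rightarrow> nat \<Rightarrow> real \<Rightarrow> bool"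
  where
  "is_ledford_tawn_coeff M F X j j' r \<eta> \<longleftrightarrow>
     0 < \<eta> \<and> \<eta> \<le> 1 \<and>
     (\<exists>L. slowly_varying_at_0 L \<and>
        lag_exceedance_prob M F X j j' r \<sim>[at_right 0] (\<lambda>t. L t * t powr (1 / \<eta> - 1)))"

definition ledford_tawn_coeff ::
  "'a measure \<Rightarrow> (real ^ 'd::finite) measure \<Rightarrow> (nat \<Rightarrow> 'a \<Rightarrow> real ^ 'd) \<Rightarrow> 'd \<Rightarrow> 'd \<Rightarrow> nat \<Rightarrow> real"
  where
  "ledford_tawn_coeff M F X j j' r = (THE \<eta>. is_ledford_tawn_coeff M F X j j' r \<eta>)"

end

theory Submission imports Defs begin

text \<open>
  Let \<open>e\<close> be the right end-point of the margin \<open>F\<^bsub>j'\<^esub>\<close>. Stationarity gives \<open>X\<^sub>r \<le> e\<close> almost surely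
  in coordinate \<open>j'\<close>, so the inherited term \<open>c X\<^sub>r\<close> in \<open>X\<^bsub>1+r\<^esub> = max (c X\<^sub>r) Y\<^bsub>1+r\<^esub>\<close> never exceeds
  \<open>c e\<close>. Because \<open>e\<close> is positive and finite and \<open>c < 1\<close>, the level \<open>c e\<close> lies strictly below \<open>e\<close>,
  and the past alone cannot produce values near the end-point: as soon as
  \<open>t \<le> 1 - F\<^bsub>j'\<^esub> (c e)\<close>, the event that \<open>X\<^bsub>1+r\<^esub>\<close> exceeds the \<open>1 - t\<close> quantile level coincides almost
  surely with the same event for the innovation \<open>Y\<^bsub>1+r\<^esub>\<close>. That innovation is independent of \<open>X\<^sub>1\<close>,
  a function of \<open>X\<^sub>0\<close> and \<open>Y\<^sub>1\<close> (lemma \<open>max_recursion_innovation_indep\<close>), so conditioning on the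
  exceedance at time 1 has no effect. By continuity of the margins every such exceedance has
  unconditional probability \<open>t\<close> (lemma \<open>continuous_cdf_exceedance_prob\<close>).

  Hence the lag-\<open>r\<close> exceedance probability is exactly \<open>t\<close> for all small \<open>t\<close>. It tends to 0, and it
  is regularly varying of index 1 and of no other index, so \<open>1 / \<eta> - 1 = 1\<close>
  (lemma \<open>ledford_tawn_of_identity\<close>).
\<close>

text \<open>The probability integral transform in tail form. The sublevel set of a continuous
  distribution function at height \<open>1 - t\<close> is a closed half-line, and its end-point is the last place
  where the value \<open>1 - t\<close> is attained; flat pieces of the distribution function thus do no harm.\<close>

lemma (in real_distribution) continuous_cdf_exceedance_prob:
  assumes cont: "continuous_on UNIV (cdf M)" and t: "0 < t" "t < 1"
  shows "measure M {x. cdf M x > 1 - t} = t"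
proof -
  let ?H = "cdf M"
  define S where "S = {x. ?H x \<le> 1 - t}"
  have "eventually (\<lambda>x. ?H x < 1 - t) at_bot"
    using order_tendstoD(2)[OF cdf_lim_at_bot, of "1 - t"] t by simp
  then obtain a where a: "?H a < 1 - t" by (auto simp: eventually_at_bot_linorder)
  have "eventually (\<lambda>x. ?H x > 1 - t) at_top"
    using order_tendstoD(1)[OF cdf_lim_at_top_prob, of "1 - t"] t by simp
  then obtain b where b: "?H b > 1 - t" by (auto simp: eventually_at_top_linorder)
  have mono: "x \<le> y \<Longrightarrow> ?H x \<le> ?H y" for x y by (rule cdf_nondecreasing)
  have ab: "a \<le> b" using a b mono[of b a] by linarith
  obtain x where x: "?H x = 1 - t"
    using IVT'[of ?H a "1 - t" b] a b ab continuous_on_subset[OF cont] by auto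
  have "closed S"
    unfolding S_def using closed_Collect_le[OF cont continuous_on_const] by simp
  have bdd: "bdd_above S"
  proof (rule bdd_aboveI)
    fix y assume "y \<in> S"
    then have "?H y < ?H b" using b by (simp add: S_def)
    then show "y \<le> b" using mono[of b y] by linarith
  qed
  have xS: "x \<in> S" using x by (simp add: S_def)
  define s where "s = Sup S"
  have sS: "s \<in> S" unfolding s_def using closed_contains_Sup[OF _ bdd \<open>closed S\<close>] xS by auto
  have "x \<le> s" unfolding s_def by (rule cSup_upper[OF xS bdd])
  then have Hs: "?H s = 1 - t" using mono[of x s] x sS by (simp add: S_def)
  have S_eq: "S = {..s}"
  proof (intro equalityI subsetI)
    show "y \<in> {..s}" if "y \<in> S" for y
      unfolding s_def using cSup_upper[OF that bdd] by simp
    show "y \<in> S" if "y \<in> {..s}" for y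
      using mono[of y s] Hs that by (simp add: S_def)
  qed
  have "{x. ?H x > 1 - t} = space M - {..s}" unfolding S_eq[symmetric] by (auto simp: S_def)
  then have "measure M {x. ?H x > 1 - t} = 1 - measure M {..s}"
    using prob_compl[of "{..s}"] by simp
  then show ?thesis using Hs by (simp add: cdf_def)
qed

text \<open>Continuity is what carries the value 1, taken everywhere to the right of the end-point,
  to the end-point itself.\<close>

lemma right_endpoint_finite:
  fixes H :: "real \<Rightarrow> real"
  assumes "mono H" "\<And>x. H x \<le> 1" "continuous_on UNIV H" "right_endpoint H = ereal e"
  shows less_one_below_right_endpoint: "\<And>x. x < e \<Longrightarrow> H x < 1"
    and eq_one_at_right_endpoint: "H e = 1"
proof -
  show "H x < 1" if "x < e" for x
  proof -
    have "ereal x < right_endpoint H" using that assms by simp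
    then obtain y where "H y < 1" "x < y"
      unfolding right_endpoint_def by (auto simp: less_SUP_iff)
    then show ?thesis using monoD[OF \<open>mono H\<close>, of x y] by simp
  qed
  have one: "H x = 1" if "e < x" for x
  proof (rule ccontr)
    assume "H x \<noteq> 1"
    then have "x \<in> {x. H x < 1}" using assms(2)[of x] by simp
    then have "ereal x \<le> right_endpoint H" unfolding right_endpoint_def by (rule SUP_upper)
    then show False using assms that by simp
  qed
  have "isCont H e" using assms(3) continuous_on_eq_continuous_at[of UNIV H] by auto
  then have "(H \<longlongrightarrow> H e) (at_right e)"
    unfolding isCont_def by (rule tendsto_within_subset) simp
  moreover have "(H \<longlongrightarrow> 1) (at_right e)"
    by (rule tendsto_eventually) (auto simp: eventually_at_filter one)
  ultimately show "H e = 1" by (rule tendsto_unique[rotated]) simp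
qed

text \<open>The index of a regularly varying function is unique: comparing the values at \<open>t\<close> and \<open>2 t\<close>
  eliminates the slowly varying factor in the limit and leaves \<open>2\<^sup>a = 2\<close>.\<close>

lemma slowly_varying_regular_variation_index:
  assumes "slowly_varying_at_0 L"
    and equiv: "(\<lambda>t::real. t) \<sim>[at_right 0] (\<lambda>t. L t * t powr a)"
  shows "a = 1"
proof -
  define q where "q t = t / (L t * t powr a)" for t
  have pos: "eventually (\<lambda>t::real. 0 < t) (at_right 0)" by (simp add: eventually_at_right_less)
  have q: "(q \<longlongrightarrow> 1) (at_right 0)"
    using equiv unfolding asymp_equiv_def
    by (rule Lim_transform_eventually) (use pos in eventually_elim, simp add: q_def)
  have "filterlim (\<lambda>t::real. t * 2) (at_right 0) (at_right 0)"
    unfolding filterlim_at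
    using tendsto_mult_left_zero[OF tendsto_ident_at[of "0::real" "{0<..}"], of 2] pos
    by (auto elim: eventually_mono)
  then have q2: "((\<lambda>t. q (t * 2)) \<longlongrightarrow> 1) (at_right 0)" by (rule filterlim_compose[OF q])
  have "((\<lambda>t. q t / q (t * 2)) \<longlongrightarrow> 1 / 1) (at_right 0)" by (intro tendsto_divide q q2) simp
  then have one: "((\<lambda>t. q t / q (t * 2)) \<longlongrightarrow> 1) (at_right 0)" by simp
  have "((\<lambda>t. L (t * 2) / L t * (2 powr a / 2)) \<longlongrightarrow> 1 * (2 powr a / 2)) (at_right 0)"
    using assms(1) by (intro tendsto_mult tendsto_const) (simp add: slowly_varying_at_0_def)
  then have "((\<lambda>t. q t / q (t * 2)) \<longlongrightarrow> 1 * (2 powr a / 2)) (at_right 0)"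
  proof (rule Lim_transform_eventually)
    show "eventually (\<lambda>t. L (t * 2) / L t * (2 powr a / 2) = q t / q (t * 2)) (at_right 0)"
      using pos by eventually_elim (simp add: q_def powr_mult field_simps)
  qed
  with one have "1 * (2 powr a / 2) = (1::real)" by (intro tendsto_unique[OF _ _ one]) simp_all
  then have "2 powr a = (2::real) powr 1" by simp
  then show ?thesis by (simp only: powr_inj)
qed

lemma ledford_tawn_of_identity:
  assumes "eventually (\<lambda>t. lag_exceedance_prob M F X j j' r t = t) (at_right 0)"
  shows "is_ledford_tawn_coeff M F X j j' r \<eta> \<longleftrightarrow> \<eta> = 1 / 2"
proof
  assume "is_ledford_tawn_coeff M F X j j' r \<eta>"
  then obtain L where "0 < \<eta>" and "slowly_varying_at_0 L"
    and "lag_exceedance_prob M F X j j' r \<sim>[at_right 0] (\<lambda>t. L t * t powr (1 / \<eta> - 1))"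
    unfolding is_ledford_tawn_coeff_def by blast
  moreover from this have "(\<lambda>t. t) \<sim>[at_right 0] (\<lambda>t. L t * t powr (1 / \<eta> - 1))"
    using asymp_equiv_transfer[OF _ assms, of _ "\<lambda>t. L t * t powr (1 / \<eta> - 1)"] by simp
  ultimately have "1 / \<eta> - 1 = 1" by (blast intro: slowly_varying_regular_variation_index)
  with \<open>0 < \<eta>\<close> show "\<eta> = 1 / 2" by (simp add: field_simps)
next
  assume [simp]: "\<eta> = 1 / 2"
  have "eventually (\<lambda>t::real. 0 < t) (at_right 0)" by (simp add: eventually_at_right_less)
  with assms have "eventually (\<lambda>t. lag_exceedance_prob M F X j j' r t = 1 * t powr (1 / \<eta> - 1)) (at_right 0)"
    by eventually_elim simp
  then have "lag_exceedance_prob M F X j j' r \<sim>[at_right 0] (\<lambda>t. 1 * t powr (1 / \<eta> - 1))"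
    by (rule asymp_equiv_refl_ev)
  moreover have "slowly_varying_at_0 (\<lambda>_. 1)" by (simp add: slowly_varying_at_0_def)
  ultimately show "is_ledford_tawn_coeff M F X j j' r \<eta>"
    unfolding is_ledford_tawn_coeff_def
    by (intro conjI exI[of _ "\<lambda>_. 1"]) simp_all
qed

lemma borel_measurable_component [measurable (raw)]:
  fixes f :: "'a \<Rightarrow> real ^ 'd::finite"
  assumes "f \<in> borel_measurable M"
  shows "(\<lambda>x. f x $ i) \<in> borel_measurable M"
  using measurable_compose[OF assms borel_measurable_nth] .

text \<open>Measurability of the process is a consequence of the recursion. It matters because \<open>distr\<close>
  along a non-measurable map does not represent the law of that map.\<close>

lemma (in prob_space) max_recursion_measurable:
  fixes X Y :: "nat \<Rightarrow> 'a \<Rightarrow> real ^ 'd::finite"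
  assumes X0: "random_variable borel (X 0)" and Y: "\<And>n. n \<ge> 1 \<Longrightarrow> random_variable borel (Y n)"
    and rec: "\<And>n i \<omega>. n \<ge> 1 \<Longrightarrow> \<omega> \<in> space M \<Longrightarrow>
           X n \<omega> $ i = max (c i * (X (n - 1) \<omega> $ i)) (Y n \<omega> $ i)"
  shows "random_variable borel (X n)"
proof (induction n)
  case (Suc n)
  have "(\<lambda>\<omega>. X (Suc n) \<omega> \<bullet> b) \<in> borel_measurable M" if b: "b \<in> Basis" for b
  proof -
    obtain i where [simp]: "b = axis i 1" using b by (auto simp: Basis_vec_def)
    have [measurable]: "X n \<in> borel_measurable M" "Y (Suc n) \<in> borel_measurable M"
      using Suc Y by auto
    have "(\<lambda>\<omega>. max (c i * (X n \<omega> $ i)) (Y (Suc n) \<omega> $ i)) \<in> borel_measurable M"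
      by measurable
    then show ?thesis
      using rec[of "Suc n" _ i] by (simp add: inner_axis cong: measurable_cong)
  qed
  then show ?case using borel_measurable_euclidean_space by blast
qed (rule X0)

text \<open>The coordinate \<open>j\<close> of \<open>X 1\<close> is a function of the sources with indices 0 and 1, and these are
  disjoint from the source with index \<open>n > 1\<close>.\<close>

lemma (in prob_space) max_recursion_innovation_indep:
  fixes X Y :: "nat \<Rightarrow> 'a \<Rightarrow> real ^ 'd::finite"
  assumes ind: "indep_vars (\<lambda>_. borel) (\<lambda>n. if n = 0 then X 0 else Y n) UNIV"
    and X1: "\<And>\<omega>. \<omega> \<in> space M \<Longrightarrow> X 1 \<omega> $ j = max (a * (X 0 \<omega> $ j)) (Y 1 \<omega> $ j)"
    and n: "1 < n" and A: "A \<in> sets borel" and B: "B \<in> sets borel"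
  shows "prob {\<omega> \<in> space M. X 1 \<omega> $ j \<in> A \<and> Y n \<omega> $ k \<in> B}
       = prob {\<omega> \<in> space M. X 1 \<omega> $ j \<in> A} * prob {\<omega> \<in> space M. Y n \<omega> $ k \<in> B}"
proof -
  let ?Z = "\<lambda>n. if n = 0 then X 0 else Y n"
  let ?f = "\<lambda>z :: nat \<Rightarrow> real ^ 'd. max (a * (z 0 $ j)) (z 1 $ j)"
  let ?g = "\<lambda>z :: nat \<Rightarrow> real ^ 'd. z n $ k"
  have "indep_var (PiM {0, 1} (\<lambda>_. borel)) (\<lambda>\<omega>. restrict (\<lambda>i. ?Z i \<omega>) {0, 1})
                  (PiM {n} (\<lambda>_. borel)) (\<lambda>\<omega>. restrict (\<lambda>i. ?Z i \<omega>) {n})"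
    using n by (intro indep_var_restrict[OF ind]) auto
  then have "indep_var borel (?f \<circ> (\<lambda>\<omega>. restrict (\<lambda>i. ?Z i \<omega>) {0, 1}))
                       borel (?g \<circ> (\<lambda>\<omega>. restrict (\<lambda>i. ?Z i \<omega>) {n}))"
    by (rule indep_var_compose)
       (intro borel_measurable_max borel_measurable_times borel_measurable_const
          borel_measurable_component measurable_component_singleton; simp)+
  then have "indep_var borel (\<lambda>\<omega>. max (a * (X 0 \<omega> $ j)) (Y 1 \<omega> $ j)) borel (\<lambda>\<omega>. Y n \<omega> $ k)"
    using n by (simp add: o_def)
  from indep_varD[OF this A B] show ?thesis
    by (simp add: X1[unfolded One_nat_def] vimage_def Int_def conj_commute cong: conj_cong)
qed

theorem proposition5p3:
  fixes M :: "'a measure"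
    and X Y :: "nat \<Rightarrow> 'a \<Rightarrow> real ^ 'd::finite"
    and F G :: "(real ^ 'd) measure"
    and c :: "'d \<Rightarrow> real"
    and j j' :: 'd
    and r :: nat
  assumes "prob_space M"
    and "\<And>i. 0 < c i \<and> c i < 1"
    and "prob_space.indep_vars M (\<lambda>_. borel) (\<lambda>n. if n = 0 then X 0 else Y n) UNIV"
    and "\<And>n. n \<ge> 1 \<Longrightarrow> distr M borel (Y n) = G"
    and "\<And>n i \<omega>. n \<ge> 1 \<Longrightarrow> \<omega> \<in> space M \<Longrightarrow>
           X n \<omega> $ i = max (c i * (X (n - 1) \<omega> $ i)) (Y n \<omega> $ i)"
    and "strictly_stationary M (\<lambda>n. X (n + 1))"
    and "\<And>n. n \<ge> 1 \<Longrightarrow> distr M borel (X n) = F"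
    and "\<And>i. continuous_on UNIV (margin_df F i)"
    and "r \<ge> 1"
    and "0 < right_endpoint (margin_df F j')" and "right_endpoint (margin_df F j') < \<infinity>"
  shows "(\<exists>l. (lag_exceedance_prob M F X j j' r \<longlongrightarrow> l) (at_right 0))
     \<and> tail_dependence_coeff M F X j j' r = 0
     \<and> (\<exists>!\<eta>. is_ledford_tawn_coeff M F X j j' r \<eta>)
     \<and> ledford_tawn_coeff M F X j j' r = 1 / 2"
proof -
  interpret prob_space M by fact
  note ind = assms(3) and rec = assms(5)
  have Y: "random_variable borel (Y n)" if "n \<ge> 1" for n
    using ind that unfolding indep_vars_def by (auto dest: spec[of _ n])
  have X0: "random_variable borel (X 0)"
    using ind unfolding indep_vars_def by (auto dest: spec[of _ 0])
  have X[measurable]: "random_variable borel (X n)" for n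
    by (rule max_recursion_measurable[where c = c and Y = Y]) (use X0 Y rec in auto)
  define H where "H = margin_df F"
  have marg: "distr F borel (\<lambda>x. x $ i) = distr M borel (\<lambda>\<omega>. X n \<omega> $ i)" if "n \<ge> 1" for n i
    unfolding assms(7)[OF that, symmetric] by (subst distr_distr) (simp_all add: o_def)
  have H_eq: "H i = cdf (distr M borel (\<lambda>\<omega>. X n \<omega> $ i))" if "n \<ge> 1" for n i
    unfolding H_def margin_df_def marg[OF that] ..
  have rd: "real_distribution (distr M borel (\<lambda>\<omega>. X n \<omega> $ i))" for n i
    by (rule real_distribution_distr) simp
  have H_mono: "mono (H i)" for i
    unfolding H_eq[of 1, OF order_refl]
    by (intro monoI finite_borel_measure.cdf_nondecreasing
        real_distribution.finite_borel_measure_M rd)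
  have H_le: "H i x \<le> 1" for i x
    unfolding H_eq[of 1, OF order_refl] by (intro real_distribution.cdf_bounded_prob rd)
  have H_cont: "continuous_on UNIV (H i)" for i using assms(8) by (simp add: H_def)
  have [measurable]: "H i \<in> borel_measurable borel" for i
    by (rule borel_measurable_continuous_onI[OF H_cont])
  have uniform: "prob {\<omega> \<in> space M. H i (X n \<omega> $ i) > 1 - t} = t"
    if "n \<ge> 1" "0 < t" "t < 1" for n i t
  proof -
    have "measure (distr M borel (\<lambda>\<omega>. X n \<omega> $ i)) {x. H i x > 1 - t} = t"
      using real_distribution.continuous_cdf_exceedance_prob[OF rd] H_cont that
      by (simp add: H_eq[OF that(1)])
    then show ?thesis
      by (subst (asm) measure_distr) (simp_all add: vimage_def Int_def conj_commute)
  qed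

  obtain e where e: "right_endpoint (H j') = ereal e" "0 < e"
    using assms(10,11) by (cases "right_endpoint (H j')") (auto simp: H_def)
  have bounded: "AE \<omega> in M. X r \<omega> $ j' \<le> e"
  proof -
    have "1 = H j' e"
      using eq_one_at_right_endpoint[OF H_mono H_le H_cont e(1)] by simp
    also have "\<dots> = prob {\<omega> \<in> space M. X r \<omega> $ j' \<le> e}"
      unfolding H_eq[OF assms(9)] cdf_def
      by (subst measure_distr) (simp_all add: vimage_def Int_def conj_commute)
    finally show ?thesis by (intro AE_I_eq_1) (simp_all add: emeasure_eq_measure)
  qed

  \<comment> \<open>The one place where \<open>e > 0\<close> is essential: for \<open>e \<le> 0\<close> the inherited term could reach the end-point.\<close>
  have "c j' * e < e" using assms(2)[of j'] e(2) by simp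
  then have gap: "H j' (c j' * e) < 1"
    by (rule less_one_below_right_endpoint[OF H_mono H_le H_cont e(1)])
  have lag: "lag_exceedance_prob M F X j j' r t = t"
    if t: "0 < t" "t < 1" "t \<le> 1 - H j' (c j' * e)" for t
  proof -
    have [measurable]: "Y (Suc r) \<in> borel_measurable M" using Y by simp
    \<comment> \<open>An exceedance at time \<open>1 + r\<close> can only be caused by the innovation of that time.\<close>
    have fresh: "AE \<omega> in M. H j' (X (1 + r) \<omega> $ j') > 1 - t \<longleftrightarrow> H j' (Y (1 + r) \<omega> $ j') > 1 - t"
      using bounded AE_space
    proof eventually_elim
      case (elim \<omega>)
      have "c j' * (X r \<omega> $ j') \<le> c j' * e"
        using elim assms(2)[of j'] by (intro mult_left_mono) auto
      then have "H j' (c j' * (X r \<omega> $ j')) \<le> 1 - t"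
        using monoD[OF H_mono, of _ "c j' * e" j'] t(3) by fastforce
      moreover have "H j' (X (1 + r) \<omega> $ j')
          = max (H j' (c j' * (X r \<omega> $ j'))) (H j' (Y (1 + r) \<omega> $ j'))"
        using rec[of "1 + r" \<omega> j'] elim by (simp add: max_of_mono[OF H_mono])
      ultimately show ?case by auto
    qed
    let ?A = "{x. H j x > 1 - t}" and ?B = "{x. H j' x > 1 - t}"
    have "prob {\<omega> \<in> space M. H j' (X (1 + r) \<omega> $ j') > 1 - t \<and> H j (X 1 \<omega> $ j) > 1 - t}
        = prob {\<omega> \<in> space M. X 1 \<omega> $ j \<in> ?A \<and> Y (1 + r) \<omega> $ j' \<in> ?B}"
      by (rule measure_eq_AE) (use fresh in auto)
    also have "\<dots> = prob {\<omega> \<in> space M. X 1 \<omega> $ j \<in> ?A} * prob {\<omega> \<in> space M. Y (1 + r) \<omega> $ j' \<in> ?B}"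
      using assms(9) rec[of 1]
      by (intro max_recursion_innovation_indep[where X = X and Y = Y and a = "c j", OF ind]) auto
    also have "prob {\<omega> \<in> space M. Y (1 + r) \<omega> $ j' \<in> ?B}
        = prob {\<omega> \<in> space M. H j' (X (1 + r) \<omega> $ j') > 1 - t}"
      by (rule measure_eq_AE) (use fresh in auto)
    finally show ?thesis
      unfolding lag_exceedance_prob_def cond_prob_def H_def[symmetric]
      using uniform[of 1 t] uniform[of "1 + r" t] t by simp
  qed
  have "eventually (\<lambda>t::real. t \<in> {0<..<min 1 (1 - H j' (c j' * e))}) (at_right 0)"
    using gap by (intro eventually_at_right_real) simp
  then have id: "eventually (\<lambda>t. lag_exceedance_prob M F X j j' r t = t) (at_right 0)"
    by eventually_elim (auto intro: lag)
  have "((\<lambda>t::real. t) \<longlongrightarrow> 0) (at_right 0)" by (rule tendsto_ident_at)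
  then have lim: "(lag_exceedance_prob M F X j j' r \<longlongrightarrow> 0) (at_right 0)"
    using tendsto_cong[OF id] by blast
  then have "tail_dependence_coeff M F X j j' r = 0"
    unfolding tail_dependence_coeff_def by (intro tendsto_Lim) simp_all
  with lim show ?thesis
    unfolding ledford_tawn_coeff_def ledford_tawn_of_identity[OF id] by blast
qed

end
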